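(* For every function $f:[0,1)\to\mathbb{R}$ there exist a set $\mathcal{K}\subset\mathbb{R}$ and a (single-valued) function $F:[0,1)\to[0,1)$ such that, writing $\Gamma=\{(x,F(x)):x\in[0,1)\}\subset\mathbb{R}^2$ for the graph of $F$: (i) $\mathcal{K}$ has cardinality continuum; (ii) the Hausdorff dimension of $\Gamma$ equals $2$; (iii) for every $k\in\mathcal{K}$ and every $C\in\mathbb{R}$, the intersection of $\Gamma$ with the graph $\{(x,kf(x)+C):x\in[0,1)\}$ consists of at most one point.
   Context: No regularity (continuity, measurability) is assumed of $f$. Hausdorff dimension is the usual one for subsets of the Euclidean plane: $H^s(E)=\lim_{\delta\to0}\inf\sum_i r_i^s$, the infimum being over all at most countable covers of $E$ by disks of radii $r_i<\delta$, and $\dim_H(E)=\inf\{s\ge 0:H^s(E)=0\}$. *)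

theory Defs
  imports "HOL-Analysis.Analysis" "HOL-Library.Equipollence"
begin

definition graph_on :: "real set \<Rightarrow> (real \<Rightarrow> real) \<Rightarrow> (real \<times> real) set" where
  "graph_on A f = {(x, f x) | x. x \<in> A}"

(* The metric on real \<times> real is the Euclidean one (dist_Pair_Pair), so balls are
   Euclidean disks. An at most countable cover is a family of disks of positive radius
   indexed by an arbitrary, possibly finite or empty, set I of natural numbers. *)
definition disk_cover ::
  "real \<Rightarrow> (real \<times> real) set \<Rightarrow> nat set \<Rightarrow> (nat \<Rightarrow> real \<times> real) \<Rightarrow> (nat \<Rightarrow> real) \<Rightarrow> bool" where
  "disk_cover \<delta> E I c r \<longleftrightarrow>
     (\<forall>i\<in>I. 0 < r i \<and> r i < \<delta>) \<and> E \<subseteq> (\<Union>i\<in>I. ball (c i) (r i))"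

definition hausdorff_premeasure :: "real \<Rightarrow> real \<Rightarrow> (real \<times> real) set \<Rightarrow> ennreal" where
  "hausdorff_premeasure s \<delta> E =
     Inf {(\<Sum>\<^sub>\<infinity>i\<in>I. ennreal (r i powr s)) | I c r. disk_cover \<delta> E I c r}"

definition hausdorff_measure :: "real \<Rightarrow> (real \<times> real) set \<Rightarrow> ennreal" where
  "hausdorff_measure s E = Lim (at_right 0) (\<lambda>\<delta>. hausdorff_premeasure s \<delta> E)"

(* The infimum is taken in ereal, where every set has one. *)
definition hausdorff_dim :: "(real \<times> real) set \<Rightarrow> ereal" where
  "hausdorff_dim E = (INF s\<in>{s. 0 \<le> s \<and> hausdorff_measure s E = 0}. ereal s)"

lemma hausdorff_premeasure_antimono:
  assumes "\<delta> \<le> \<delta>'"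
  shows "hausdorff_premeasure s \<delta>' E \<le> hausdorff_premeasure s \<delta> E"
  unfolding hausdorff_premeasure_def
proof (rule Inf_superset_mono)
  have "disk_cover \<delta>' E I c r" if "disk_cover \<delta> E I c r" for I c r
    using that assms unfolding disk_cover_def by fastforce
  then show "{(\<Sum>\<^sub>\<infinity>i\<in>I. ennreal (r i powr s)) | I c r. disk_cover \<delta> E I c r} \<subseteq>
        {(\<Sum>\<^sub>\<infinity>i\<in>I. ennreal (r i powr s)) | I c r. disk_cover \<delta>' E I c r}"
    by blast
qed

(* The limit in hausdorff_measure always exists. *)
lemma hausdorff_premeasure_tendsto_SUP:
  "((\<lambda>\<delta>. hausdorff_premeasure s \<delta> E) \<longlongrightarrow> (SUP \<delta>\<in>{0<..}. hausdorff_premeasure s \<delta> E)) (at_right 0)"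
proof (rule order_tendstoI)
  fix a assume "a < (SUP \<delta>\<in>{0<..}. hausdorff_premeasure s \<delta> E)"
  then obtain d where d: "d > 0" "a < hausdorff_premeasure s d E"
    by (auto simp: less_SUP_iff)
  have "a < hausdorff_premeasure s x E" if "x < d" for x
    using hausdorff_premeasure_antimono[of x d s E] that d(2) by auto
  then show "eventually (\<lambda>\<delta>. a < hausdorff_premeasure s \<delta> E) (at_right 0)"
    using d(1) by (auto simp: eventually_at_right_field)
next
  fix a assume a: "(SUP \<delta>\<in>{0<..}. hausdorff_premeasure s \<delta> E) < a"
  have "hausdorff_premeasure s x E < a" if "x > 0" for x
    using a that by (meson SUP_upper greaterThan_iff le_less_trans)
  then show "eventually (\<lambda>\<delta>. hausdorff_premeasure s \<delta> E < a) (at_right 0)"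
    by (auto simp: eventually_at_right_field intro: exI[of _ 1])
qed

lemma hausdorff_measure_eq_SUP:
  "hausdorff_measure s E = (SUP \<delta>\<in>{0<..}. hausdorff_premeasure s \<delta> E)"
  unfolding hausdorff_measure_def
  by (rule tendsto_Lim[OF _ hausdorff_premeasure_tendsto_SUP]) simp

end

theory Submission
  imports Defs "HOL-Computational_Algebra.Polynomial"
begin

text \<open>
  The difference of \<open>F\<close> and \<open>k f + C\<close> has at most one zero for every \<open>C\<close> exactly when
  \<open>F - k f\<close> is injective. So the task is to find a set \<open>K\<close> of size continuum and a function \<open>F\<close>
  with \<open>F x - F y \<noteq> k (f x - f y)\<close> for all \<open>x \<noteq> y\<close> and \<open>k \<in> K\<close>, whose graph is so scattered that
  it meets every compact subset of positive area of a square. Such a graph has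
  positive outer area, hence dimension 2, by the easy comparison of a disk of radius \<open>r\<close> with
  its area.

  The values of \<open>F\<close> are chosen one by one along a well-order of the reals all of whose initial
  segments have size less than continuum. At stage \<open>x\<close> the value has to lie in a prescribed
  compact set of positive length (a vertical section of the planar set to be met, if one was
  assigned to \<open>x\<close>), and it has to avoid the affine copies \<open>F y + (f x - f y) K\<close> for all earlier
  \<open>y\<close>. These are fewer than continuum many copies of \<open>K\<close>, with no control at all on how they are
  placed, so \<open>K\<close> must be such that no family of this kind covers a compact set of positive length
  (\<open>affine_copies_do_not_cover\<close>).

  Such a \<open>K\<close> is a subring \<open>D\<close> of the reals which has size continuum and over which some
  number \<open>t\<close> satisfies no nontrivial polynomial equation of degree at most 2; it comes from
  Zorn's lemma (\<open>exists_large_subring\<close>). If the copies \<open>b i + a i D\<close> covered \<open>P\<close>, the sets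
  \<open>b i - b j + a i D + a j D\<close> would cover the difference set of \<open>P\<close>, which contains an interval
  around 0 (\<open>Steinhaus\<close>), and integer multiples of them would cover the whole line. These are
  planes over \<open>D\<close>, while \<open>1, t, t\<^sup>2\<close> span a three-dimensional space over \<open>D\<close>. The twisted cubic
  \<open>s + s\<^sup>2 t + s\<^sup>3 t\<^sup>2\<close> in that space has continuum many points with \<open>s \<in> D\<close> and meets each plane in
  at most three of them (\<open>finite_curve_plane\<close>), so fewer than continuum many planes do not
  suffice.
\<close>

section \<open>Sets of size less than continuum\<close>

lemma countable_lesspoll_reals:
  assumes "countable A"
  shows "A \<prec> (UNIV :: real set)"
proof -
  have "\<not> (UNIV :: real set) \<lesssim> A"
    using assms countable_lepoll uncountable_UNIV_real by blast
  moreover have "A \<lesssim> (UNIV :: nat set)"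
    using assms by (auto simp: countable_def lepoll_def)
  then have "A \<lesssim> (UNIV :: real set)"
    using infinite_UNIV_char_0 infinite_le_lepoll lepoll_trans by blast
  ultimately show ?thesis
    by (simp add: lesspoll_def eqpoll_imp_lepoll eqpoll_sym) (meson eqpoll_imp_lepoll eqpoll_sym)
qed

lemma infinite_Times_lepoll:
  assumes "infinite C" "A \<lesssim> C" "B \<lesssim> C"
  shows "A \<times> B \<lesssim> C"
proof -
  have "C \<times> C \<approx> C"
    using card_of_Times_same_infinite[OF assms(1)] by (simp add: eqpoll_iff_card_of_ordIso)
  then show ?thesis
    using times_lepoll_mono[OF assms(2,3)] lepoll_trans2 by blast
qed

lemma infinite_UN_lepoll:
  assumes "infinite C" "I \<lesssim> C" "\<And>i. i \<in> I \<Longrightarrow> A i \<lesssim> C"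
  shows "(\<Union>i\<in>I. A i) \<lesssim> C"
  using assms card_of_UNION_ordLeq_infinite[of C I A]
  by (simp add: lepoll_def card_of_ordLeq)

lemma Times_lesspoll_reals:
  assumes "A \<prec> (UNIV :: real set)" "B \<prec> (UNIV :: real set)"
  shows "A \<times> B \<prec> (UNIV :: real set)"
proof (cases "finite A \<and> finite B")
  case True
  then show ?thesis
    by (simp add: countable_finite countable_lesspoll_reals)
next
  case False
  have "A \<lesssim> B \<or> B \<lesssim> A"
    by (metis card_of_Well_order card_of_ordLeq lepoll_def ordLeq_total)
  then consider "A \<lesssim> B" "infinite B" | "B \<lesssim> A" "infinite A"
    using False by (meson lepoll_iff lepoll_def finite_subset finite_imageI)
  then show ?thesis
    by cases (use assms infinite_Times_lepoll lepoll_refl lesspoll_trans1 in metis)+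
qed

text \<open>
  For infinite \<open>J\<close> the union is no larger than \<open>J\<close>. Merely assuming every \<open>B j\<close> to be smaller
  than the continuum would not do, because the continuum need not be a regular cardinal.
\<close>
lemma UN_countable_lesspoll_reals:
  assumes "J \<prec> (UNIV :: real set)" "\<And>j. j \<in> J \<Longrightarrow> countable (B j)"
  shows "(\<Union>j\<in>J. B j) \<prec> (UNIV :: real set)"
proof (cases "finite J")
  case True
  then show ?thesis
    using assms(2) by (intro countable_lesspoll_reals) (auto intro: countable_finite)
next
  case False
  have "B j \<lesssim> J" if "j \<in> J" for j
  proof -
    have "B j \<lesssim> (UNIV :: nat set)"
      using assms(2)[OF that] by (auto simp: countable_def lepoll_def)
    then show ?thesis
      using False infinite_le_lepoll lepoll_trans by blast
  qed
  then have "(\<Union>j\<in>J. B j) \<lesssim> J"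
    using False by (intro infinite_UN_lepoll) auto
  then show ?thesis
    using assms(1) lesspoll_trans1 by blast
qed


section \<open>A large subring over which some number is not quadratic\<close>

text \<open>
  The polynomials are exhausted by countably many sets, by degree, each obtained from the previous
  one by adding a new constant term; each of them has at most the size of \<open>D\<close>, uniformly in the
  degree.
\<close>
lemma polys_lepoll:
  fixes D :: "real set"
  assumes "infinite D"
  shows "{p :: real poly. set (coeffs p) \<subseteq> D} \<lesssim> D"
proof -
  define S where "S = rec_nat {0 :: real poly} (\<lambda>_ X. (\<lambda>(a, p). pCons a p) ` (D \<times> X))"
  have S0: "S 0 = {0}" and SS: "S (Suc n) = (\<lambda>(a, p). pCons a p) ` (D \<times> S n)" for n
    by (simp_all add: S_def)
  have le: "S n \<lesssim> D" for n
  proof (induction n)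
    case 0
    show ?case
      unfolding S0 using assms by (simp add: finite_lepoll_infinite)
  next
    case (Suc n)
    then have "D \<times> S n \<lesssim> D"
      by (intro infinite_Times_lepoll assms) auto
    then show ?case
      unfolding SS using image_lepoll lepoll_trans by blast
  qed
  have "set (coeffs p) \<subseteq> D \<longrightarrow> (\<exists>n. p \<in> S n)" for p
  proof (induction p)
    case 0
    then show ?case using S0 by blast
  next
    case (pCons a p)
    show ?case
    proof
      assume *: "set (coeffs (pCons a p)) \<subseteq> D"
      then have "a \<in> D" "set (coeffs p) \<subseteq> D"
        using pCons.hyps by (auto simp: cCons_def split: if_splits)
      with pCons.IH obtain n where "p \<in> S n" by blast
      with \<open>a \<in> D\<close> have "pCons a p \<in> S (Suc n)"
        by (force simp: SS)
      then show "\<exists>n. pCons a p \<in> S n" by blast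
    qed
  qed
  then have "{p. set (coeffs p) \<subseteq> D} \<subseteq> (\<Union>n. S n)"
    by blast
  moreover have "(\<Union>n. S n) \<lesssim> D"
    using assms infinite_le_lepoll le by (intro infinite_UN_lepoll) auto
  ultimately show ?thesis
    using subset_imp_lepoll lepoll_trans by blast
qed

text \<open>
  There are fewer than continuum many nonzero polynomials over \<open>D\<close>, each with finitely many roots.
\<close>
lemma exists_transcendental_over:
  fixes D :: "real set"
  assumes "infinite D" "D \<prec> (UNIV :: real set)"
  obtains z where "\<And>p. p \<noteq> 0 \<Longrightarrow> set (coeffs p) \<subseteq> D \<Longrightarrow> poly p z \<noteq> 0"
proof -
  let ?P = "{p. p \<noteq> 0 \<and> set (coeffs p) \<subseteq> D}"
  have "?P \<lesssim> {p. set (coeffs p) \<subseteq> D}"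
    by (rule subset_imp_lepoll) auto
  then have "?P \<lesssim> D"
    using polys_lepoll[OF assms(1)] lepoll_trans by blast
  then have "?P \<prec> (UNIV :: real set)"
    using assms(2) lesspoll_trans1 by blast
  then have "(\<Union>p\<in>?P. {z. poly p z = 0}) \<prec> (UNIV :: real set)"
    by (rule UN_countable_lesspoll_reals) (auto intro: countable_finite poly_roots_finite)
  then have "(\<Union>p\<in>?P. {z. poly p z = 0}) \<noteq> UNIV"
    by auto
  then show ?thesis
    using that by blast
qed

definition real_subring :: "real set \<Rightarrow> bool" where
  "real_subring D \<longleftrightarrow> 1 \<in> D \<and> (\<forall>a\<in>D. \<forall>b\<in>D. a - b \<in> D \<and> a * b \<in> D)"

text \<open>
  Equivalently, \<open>1, t, t\<^sup>2\<close> are linearly independent over \<open>D\<close>.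
\<close>
definition no_quadratic :: "real set \<Rightarrow> real \<Rightarrow> bool" where
  "no_quadratic D t \<longleftrightarrow>
     (\<forall>a\<in>D. \<forall>b\<in>D. \<forall>c\<in>D. a + b * t + c * t\<^sup>2 = 0 \<longrightarrow> a = 0 \<and> b = 0 \<and> c = 0)"

lemma
  assumes "real_subring D"
  shows subring_0: "0 \<in> D" and subring_1: "1 \<in> D"
    and subring_diff: "a \<in> D \<Longrightarrow> b \<in> D \<Longrightarrow> a - b \<in> D"
    and subring_mult: "a \<in> D \<Longrightarrow> b \<in> D \<Longrightarrow> a * b \<in> D"
    and subring_minus: "a \<in> D \<Longrightarrow> - a \<in> D"
    and subring_add: "a \<in> D \<Longrightarrow> b \<in> D \<Longrightarrow> a + b \<in> D"
proof -
  show 1: "1 \<in> D" and d: "a \<in> D \<Longrightarrow> b \<in> D \<Longrightarrow> a - b \<in> D"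
    and "a \<in> D \<Longrightarrow> b \<in> D \<Longrightarrow> a * b \<in> D" for a b
    using assms by (auto simp: real_subring_def)
  show 0: "0 \<in> D" using d[OF 1 1] by simp
  show m: "a \<in> D \<Longrightarrow> - a \<in> D" for a using d[OF 0] by fastforce
  show "a \<in> D \<Longrightarrow> b \<in> D \<Longrightarrow> a + b \<in> D" using d[of a "- b"] m[of b] by simp
qed

lemma subring_sum:
  assumes "real_subring D" "\<And>i. i \<in> A \<Longrightarrow> g i \<in> D"
  shows "sum g A \<in> D"
  using assms(2) by (induction A rule: infinite_finite_induct)
    (auto intro: subring_0 subring_add assms(1))

lemma subring_infinite:
  assumes "real_subring D"
  shows "infinite D"
proof -
  have "of_nat n \<in> D" for n
    by (induction n) (auto intro: subring_0 subring_1 subring_add assms)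
  then have "\<nat> \<subseteq> D"
    by (auto simp: Nats_def)
  moreover have "infinite (\<nat> :: real set)"
    unfolding Nats_def by (rule range_inj_infinite) (simp add: inj_of_nat)
  ultimately show ?thesis
    using finite_subset by blast
qed

text \<open>
  Adjoin a number \<open>z\<close> which is transcendental not only over \<open>D\<close> but over the larger set \<open>E\<close> of all
  \<open>a + b t + c t\<^sup>2\<close>. A quadratic equation for \<open>t\<close> with coefficients \<open>p(z), q(z), r(z)\<close> is then a
  polynomial equation for \<open>z\<close> over \<open>E\<close>, hence trivial coefficient by coefficient.
\<close>
lemma subring_adjoin:
  assumes D: "real_subring D" and t: "no_quadratic D t" and small: "D \<prec> (UNIV :: real set)"
  obtains D' where "real_subring D'" "no_quadratic D' t" "D \<subset> D'"
proof -
  let ?g = "\<lambda>(a, b, c). a + b * t + c * t\<^sup>2"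
  define E where "E = ?g ` (D \<times> D \<times> D)"
  have EI: "a + b * t + c * t\<^sup>2 \<in> E" if "a \<in> D" "b \<in> D" "c \<in> D" for a b c
    using that unfolding E_def by force
  have DE: "D \<subseteq> E"
    using EI[OF _ subring_0[OF D] subring_0[OF D]] by auto
  have "D \<times> D \<times> D \<prec> (UNIV :: real set)"
    by (intro Times_lesspoll_reals small)
  then have "E \<prec> (UNIV :: real set)"
    unfolding E_def using image_lepoll lesspoll_trans1 by blast
  moreover have "infinite E"
    using DE subring_infinite[OF D] finite_subset by blast
  ultimately obtain z where z: "\<And>p. p \<noteq> 0 \<Longrightarrow> set (coeffs p) \<subseteq> E \<Longrightarrow> poly p z \<noteq> 0"
    using exists_transcendental_over by metis
  define D' where "D' = {poly p z | p. \<forall>i. coeff p i \<in> D}"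
  have D'I: "poly p z \<in> D'" if "\<And>i. coeff p i \<in> D" for p
    using that unfolding D'_def by blast
  have "real_subring D'"
    unfolding real_subring_def
  proof (intro conjI ballI)
    have "poly 1 z \<in> D'"
      by (rule D'I) (simp add: coeff_1 subring_0[OF D] subring_1[OF D])
    then show "1 \<in> D'" by simp
    fix a b assume "a \<in> D'" "b \<in> D'"
    then obtain p q where pq: "a = poly p z" "b = poly q z"
      "\<And>i. coeff p i \<in> D" "\<And>i. coeff q i \<in> D"
      unfolding D'_def by blast
    have "poly (p - q) z \<in> D'"
      by (rule D'I) (simp add: pq subring_diff[OF D])
    then show "a - b \<in> D'" by (simp add: pq)
    have "poly (p * q) z \<in> D'"
      by (rule D'I) (auto simp: coeff_mult pq intro!: subring_sum[OF D] subring_mult[OF D])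
    then show "a * b \<in> D'" by (simp add: pq)
  qed
  moreover have "no_quadratic D' t"
    unfolding no_quadratic_def
  proof (intro ballI impI)
    fix a b c assume "a \<in> D'" "b \<in> D'" "c \<in> D'" and eq: "a + b * t + c * t\<^sup>2 = 0"
    then obtain p q r where pqr: "a = poly p z" "b = poly q z" "c = poly r z"
      "\<And>i. coeff p i \<in> D" "\<And>i. coeff q i \<in> D" "\<And>i. coeff r i \<in> D"
      unfolding D'_def by blast
    define P where "P = p + smult t q + smult (t\<^sup>2) r"
    have cP: "coeff P i = coeff p i + coeff q i * t + coeff r i * t\<^sup>2" for i
      by (simp add: P_def mult.commute)
    have "set (coeffs P) \<subseteq> E"
      using pqr(4-6) by (auto simp: coeffs_def cP intro!: EI split: if_splits)
    moreover have "poly P z = 0"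
      using eq by (simp add: P_def pqr(1-3) mult.commute)
    ultimately have "P = 0"
      using z by blast
    then have "coeff p i + coeff q i * t + coeff r i * t\<^sup>2 = 0" for i
      using cP[of i] by simp
    then have "coeff p i = 0 \<and> coeff q i = 0 \<and> coeff r i = 0" for i
      using t pqr(4-6) unfolding no_quadratic_def by blast
    then have "p = 0" "q = 0" "r = 0"
      by (auto intro!: poly_eqI)
    then show "a = 0 \<and> b = 0 \<and> c = 0"
      by (simp add: pqr(1-3))
  qed
  moreover have "D \<subset> D'"
  proof
    show "D \<subseteq> D'"
    proof
      fix a assume "a \<in> D"
      then have "poly [:a:] z \<in> D'"
        by (intro D'I) (auto simp: coeff_pCons subring_0[OF D] split: nat.split)
      then show "a \<in> D'" by simp
    qed
    have "poly [:0, 1:] z \<in> D'"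
      by (rule D'I) (auto simp: coeff_pCons subring_0[OF D] subring_1[OF D] split: nat.split)
    then have "z \<in> D'" by simp
    moreover have "z \<notin> D"
    proof
      assume "z \<in> D"
      then have "set (coeffs [:- z, 1:]) \<subseteq> E"
        using DE subring_minus[OF D] subring_1[OF D] by auto
      then show False
        using z[of "[:- z, 1:]"] by simp
    qed
    ultimately show "D \<noteq> D'" by blast
  qed
  ultimately show ?thesis
    using that by blast
qed

text \<open>
  Start from the integers and a transcendental \<open>t\<close>, and take a maximal subring: by
  \<open>subring_adjoin\<close> its size cannot be less than continuum.
\<close>
lemma exists_large_subring:
  obtains D t where "real_subring D" "no_quadratic D t" "D \<approx> (UNIV :: real set)"
proof -
  have Z: "real_subring \<int>"
    by (simp add: real_subring_def)
  have "countable (\<int> :: real set)"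
    by (simp add: Ints_def)
  then obtain t where t: "\<And>p. p \<noteq> 0 \<Longrightarrow> set (coeffs p) \<subseteq> \<int> \<Longrightarrow> poly p t \<noteq> (0 :: real)"
    using exists_transcendental_over[of \<int>] countable_lesspoll_reals subring_infinite[OF Z] by metis
  have "no_quadratic \<int> t"
    unfolding no_quadratic_def
  proof (intro ballI impI)
    fix a b c :: real assume "a \<in> \<int>" "b \<in> \<int>" "c \<in> \<int>" "a + b * t + c * t\<^sup>2 = 0"
    moreover from this have "set (coeffs [:a, b, c:]) \<subseteq> \<int>"
      by (auto simp: cCons_def)
    moreover have "poly [:a, b, c:] t = a + b * t + c * t\<^sup>2"
      by (simp add: algebra_simps power2_eq_square)
    ultimately have "[:a, b, c:] = 0"
      using t by metis
    then show "a = 0 \<and> b = 0 \<and> c = 0" by simp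
  qed
  define \<A> where "\<A> = {D. real_subring D \<and> no_quadratic D t}"
  have "\<exists>M\<in>\<A>. \<forall>X\<in>\<A>. M \<subseteq> X \<longrightarrow> X = M"
  proof (rule subset_Zorn_nonempty)
    show "\<A> \<noteq> {}"
      using Z \<open>no_quadratic \<int> t\<close> by (auto simp: \<A>_def)
    fix \<C> assume ne: "\<C> \<noteq> {}" and ch: "subset.chain \<A> \<C>"
    have sub: "X \<in> \<C> \<Longrightarrow> real_subring X \<and> no_quadratic X t" for X
      using ch by (auto simp: subset.chain_def \<A>_def)
    have two: "\<exists>X\<in>\<C>. a \<in> X \<and> b \<in> X" if "a \<in> \<Union>\<C>" "b \<in> \<Union>\<C>" for a b
    proof -
      obtain X Y where XY: "X \<in> \<C>" "a \<in> X" "Y \<in> \<C>" "b \<in> Y"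
        using \<open>a \<in> \<Union>\<C>\<close> \<open>b \<in> \<Union>\<C>\<close> by blast
      then have "X \<subseteq> Y \<or> Y \<subseteq> X"
        using ch unfolding subset_chain_def by blast
      with XY show ?thesis by blast
    qed
    have three: "\<exists>X\<in>\<C>. a \<in> X \<and> b \<in> X \<and> c \<in> X"
      if abc: "a \<in> \<Union>\<C>" "b \<in> \<Union>\<C>" "c \<in> \<Union>\<C>" for a b c
    proof -
      obtain X where X: "X \<in> \<C>" "a \<in> X" "b \<in> X"
        using two[OF abc(1,2)] by blast
      obtain Y where Y: "Y \<in> \<C>" "c \<in> Y"
        using abc(3) by blast
      have "X \<subseteq> Y \<or> Y \<subseteq> X"
        using ch X Y unfolding subset_chain_def by blast
      with X Y show ?thesis by blast
    qed
    have "real_subring (\<Union>\<C>)"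
      unfolding real_subring_def
    proof (intro conjI ballI)
      show "1 \<in> \<Union>\<C>"
        using ne sub subring_1 by blast
      fix a b assume "a \<in> \<Union>\<C>" "b \<in> \<Union>\<C>"
      then obtain X where "X \<in> \<C>" "a \<in> X" "b \<in> X"
        using two by blast
      then show "a - b \<in> \<Union>\<C>" "a * b \<in> \<Union>\<C>"
        using sub subring_diff subring_mult by blast+
    qed
    moreover have "no_quadratic (\<Union>\<C>) t"
      unfolding no_quadratic_def
    proof (intro ballI impI)
      fix a b c assume abc: "a \<in> \<Union>\<C>" "b \<in> \<Union>\<C>" "c \<in> \<Union>\<C>"
        and eq: "a + b * t + c * t\<^sup>2 = 0"
      obtain X where X: "X \<in> \<C>" "a \<in> X" "b \<in> X" "c \<in> X"
        using three[OF abc] by blast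
      have "no_quadratic X t"
        using sub X(1) by blast
      then show "a = 0 \<and> b = 0 \<and> c = 0"
        using X(2-4) eq unfolding no_quadratic_def by blast
    qed
    ultimately show "\<Union>\<C> \<in> \<A>"
      by (simp add: \<A>_def)
  qed
  then obtain D where D: "real_subring D" "no_quadratic D t"
    and max: "\<And>X. real_subring X \<Longrightarrow> no_quadratic X t \<Longrightarrow> D \<subseteq> X \<Longrightarrow> X = D"
    by (auto simp: \<A>_def)
  have "\<not> D \<prec> (UNIV :: real set)"
    using subring_adjoin[OF D] max by (metis psubsetE)
  then have "D \<approx> (UNIV :: real set)"
    using lepoll_iff_leqpoll subset_imp_lepoll by blast
  then show ?thesis
    using that D by blast
qed

section \<open>A cubic curve meets planes over a subring in few points\<close>

text \<open>
  Evaluate the functional \<open>p \<mapsto> w1 p(s1) + w2 p(s2) + w3 p(s3)\<close>, which kills all polynomials of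
  degree at most 2, at the polynomial with roots \<open>s2, s3\<close>.
\<close>
lemma vandermonde_3:
  fixes w1 w2 w3 s1 s2 s3 :: real
  assumes "w1 + w2 + w3 = 0" "w1 * s1 + w2 * s2 + w3 * s3 = 0"
    "w1 * s1\<^sup>2 + w2 * s2\<^sup>2 + w3 * s3\<^sup>2 = 0" and "s1 \<noteq> s2" "s1 \<noteq> s3"
  shows "w1 = 0"
proof -
  have "w1 * ((s1 - s2) * (s1 - s3)) =
      (w1 * s1\<^sup>2 + w2 * s2\<^sup>2 + w3 * s3\<^sup>2) - (s2 + s3) * (w1 * s1 + w2 * s2 + w3 * s3)
      + s2 * s3 * (w1 + w2 + w3)"
    by (simp add: algebra_simps power2_eq_square)
  then show ?thesis
    using assms by simp
qed

text \<open>
  Three elements of the \<open>D\<close>-module generated by two reals \<open>a, a'\<close> satisfy a linear relation over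
  \<open>D\<close>. In general the cross product of the coordinate vectors gives one; if it vanishes, the
  vectors are parallel and two of them, or one of them if it is zero, give a relation. No
  division is involved, so a subring is enough.
\<close>
lemma subring_relation:
  assumes D: "real_subring D" and xy: "x1 \<in> D" "x2 \<in> D" "x3 \<in> D" "y1 \<in> D" "y2 \<in> D" "y3 \<in> D"
  obtains c1 c2 c3 where "c1 \<in> D" "c2 \<in> D" "c3 \<in> D" "c1 \<noteq> 0 \<or> c2 \<noteq> 0 \<or> c3 \<noteq> 0"
    "c1 * (a * x1 + a' * y1) + c2 * (a * x2 + a' * y2) + c3 * (a * x3 + a' * y3) = 0"
proof -
  let ?c1 = "x2 * y3 - x3 * y2" and ?c2 = "x3 * y1 - x1 * y3" and ?c3 = "x1 * y2 - x2 * y1"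
  note cl = subring_diff[OF D] subring_mult[OF D] subring_minus[OF D] subring_0[OF D] subring_1[OF D] xy
  consider "?c1 \<noteq> 0 \<or> ?c2 \<noteq> 0 \<or> ?c3 \<noteq> 0" | "?c3 = 0" "x1 \<noteq> 0" | "?c3 = 0" "y1 \<noteq> 0"
    | "x1 = 0" "y1 = 0"
    by blast
  then show ?thesis
  proof cases
    case 1
    show ?thesis
      by (rule that[of ?c1 ?c2 ?c3]) (use 1 in \<open>auto intro: cl simp: algebra_simps\<close>)
  next
    case 2
    have "- x2 * (a * x1 + a' * y1) + x1 * (a * x2 + a' * y2) = a' * ?c3"
      by (simp add: algebra_simps)
    then show ?thesis
      by (intro that[of "- x2" x1 0]) (use 2 in \<open>auto intro: cl\<close>)
  next
    case 3
    have "- y2 * (a * x1 + a' * y1) + y1 * (a * x2 + a' * y2) = - a * ?c3"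
      by (simp add: algebra_simps)
    then show ?thesis
      by (intro that[of "- y2" y1 0]) (use 3 in \<open>auto intro: cl\<close>)
  next
    case 4
    show ?thesis
      by (rule that[of 1 0 0]) (use 4 in \<open>auto intro: cl\<close>)
  qed
qed

text \<open>
  Four points of the curve in one plane give three differences in the \<open>D\<close>-module generated by
  \<open>a, a'\<close>, hence a nontrivial relation over \<open>D\<close> between them. As \<open>1, t, t\<^sup>2\<close> are independent over
  \<open>D\<close>, the relation splits into one for each of the powers \<open>s, s\<^sup>2, s\<^sup>3\<close>, which a
  Vandermonde determinant rules out.
\<close>
lemma finite_curve_plane:
  assumes D: "real_subring D" and t: "no_quadratic D t"
  shows "finite {s \<in> D. \<exists>x\<in>D. \<exists>y\<in>D. s + s\<^sup>2 * t + s ^ 3 * t\<^sup>2 = b + a * x + a' * y}"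
    (is "finite ?S")
proof (rule ccontr)
  assume "infinite ?S"
  then have "\<exists>T. finite T \<and> card T = 4 \<and> T \<subseteq> ?S"
    by (rule infinite_arbitrarily_large)
  then obtain T where T: "T \<subseteq> ?S" "card T = 4"
    by blast
  have "card T = Suc (Suc (Suc (Suc 0)))"
    using T(2) by simp
  then obtain s1 s2 s3 s4 where s: "T = {s1, s2, s3, s4}"
    and ne: "s1 \<noteq> s2" "s1 \<noteq> s3" "s1 \<noteq> s4" "s2 \<noteq> s3" "s2 \<noteq> s4" "s3 \<noteq> s4"
    by (auto simp: card_Suc_eq)
  let ?q = "\<lambda>s. s + s\<^sup>2 * t + s ^ 3 * t\<^sup>2"
  have sS: "s1 \<in> ?S" "s2 \<in> ?S" "s3 \<in> ?S" "s4 \<in> ?S"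
    using T(1) s by auto
  have sD: "s1 \<in> D" "s2 \<in> D" "s3 \<in> D" "s4 \<in> D"
    using sS by simp_all
  have wit: "\<exists>x y. x \<in> D \<and> y \<in> D \<and> ?q s = b + a * x + a' * y" if "s \<in> ?S" for s
    using that by blast
  obtain x1 y1 where 1: "x1 \<in> D" "y1 \<in> D" "?q s1 = b + a * x1 + a' * y1"
    using wit[OF sS(1)] by blast
  obtain x2 y2 where 2: "x2 \<in> D" "y2 \<in> D" "?q s2 = b + a * x2 + a' * y2"
    using wit[OF sS(2)] by blast
  obtain x3 y3 where 3: "x3 \<in> D" "y3 \<in> D" "?q s3 = b + a * x3 + a' * y3"
    using wit[OF sS(3)] by blast
  obtain x4 y4 where 4: "x4 \<in> D" "y4 \<in> D" "?q s4 = b + a * x4 + a' * y4"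
    using wit[OF sS(4)] by blast
  note xy = 1(1,2) 2(1,2) 3(1,2) 4(1,2) and q = 1(3) 2(3) 3(3) 4(3)
  obtain c1 c2 c3 where c: "c1 \<in> D" "c2 \<in> D" "c3 \<in> D" "c1 \<noteq> 0 \<or> c2 \<noteq> 0 \<or> c3 \<noteq> 0"
    and rel: "c1 * (a * (x1 - x4) + a' * (y1 - y4)) + c2 * (a * (x2 - x4) + a' * (y2 - y4))
      + c3 * (a * (x3 - x4) + a' * (y3 - y4)) = 0"
    by (rule subring_relation[OF D, of "x1 - x4" "x2 - x4" "x3 - x4" "y1 - y4" "y2 - y4" "y3 - y4" a a'])
      (intro subring_diff[OF D] xy)+
  have d: "?q s1 - ?q s4 = a * (x1 - x4) + a' * (y1 - y4)"
    "?q s2 - ?q s4 = a * (x2 - x4) + a' * (y2 - y4)"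
    "?q s3 - ?q s4 = a * (x3 - x4) + a' * (y3 - y4)"
    unfolding q by (simp_all add: algebra_simps)
  have rel': "c1 * (?q s1 - ?q s4) + c2 * (?q s2 - ?q s4) + c3 * (?q s3 - ?q s4) = 0"
    unfolding d by (rule rel)
  \<comment> \<open>the coefficient of \<open>t ^ (k - 1)\<close> in the relation\<close>
  define m where "m k = c1 * (s1 ^ k - s4 ^ k) + c2 * (s2 ^ k - s4 ^ k) + c3 * (s3 ^ k - s4 ^ k)" for k
  have pw: "u ^ k \<in> D" if "u \<in> D" for u and k :: nat
    by (induction k) (auto intro: subring_1[OF D] subring_mult[OF D] that)
  have mD: "m k \<in> D" for k
    unfolding m_def by (intro subring_add[OF D] subring_mult[OF D] subring_diff[OF D] pw c sD)
  have "m 1 + m 2 * t + m 3 * t\<^sup>2 = 0"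
    using rel' unfolding m_def by (simp add: algebra_simps)
  then have m: "m 1 = 0" "m 2 = 0" "m 3 = 0"
    using t mD unfolding no_quadratic_def by blast+
  \<comment> \<open>dividing \<open>s\<^sub>i ^ k - s\<^sub>4 ^ k\<close> by the common factor \<open>s\<^sub>i - s\<^sub>4\<close> leaves combinations of weighted power sums of \<open>s\<^sub>1, s\<^sub>2, s\<^sub>3\<close>\<close>
  define w1 w2 w3 where "w1 = c1 * (s1 - s4)" and "w2 = c2 * (s2 - s4)" and "w3 = c3 * (s3 - s4)"
  have w: "w1 + w2 + w3 = 0"
    using m(1) by (simp add: m_def w1_def w2_def w3_def)
  have "w1 * s1 + w2 * s2 + w3 * s3 = m 2 - s4 * (w1 + w2 + w3)"
    by (simp add: m_def w1_def w2_def w3_def algebra_simps power2_eq_square)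
  with m w have ws: "w1 * s1 + w2 * s2 + w3 * s3 = 0" by simp
  have "w1 * s1\<^sup>2 + w2 * s2\<^sup>2 + w3 * s3\<^sup>2
      = m 3 - s4 * (w1 * s1 + w2 * s2 + w3 * s3) - s4\<^sup>2 * (w1 + w2 + w3)"
    by (simp add: m_def w1_def w2_def w3_def algebra_simps power2_eq_square power3_eq_cube)
  with m w ws have wss: "w1 * s1\<^sup>2 + w2 * s2\<^sup>2 + w3 * s3\<^sup>2 = 0" by simp
  have "w1 = 0"
    by (rule vandermonde_3[OF w ws wss]) (use ne in auto)
  moreover have "w2 = 0"
    by (rule vandermonde_3[of w2 w1 w3 s2 s1 s3]) (use w ws wss ne in \<open>linarith | simp\<close>)+
  moreover have "w3 = 0"
    by (rule vandermonde_3[of w3 w1 w2 s3 s1 s2]) (use w ws wss ne in \<open>linarith | simp\<close>)+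
  ultimately show False
    using c(4) ne by (simp add: w1_def w2_def w3_def)
qed


section \<open>Sets of positive Lebesgue measure\<close>

text \<open>
  An open \<open>U\<close> containing \<open>P\<close> whose measure is less than twice that of \<open>P\<close> also contains all
  translates of \<open>P\<close> by less than the distance of \<open>P\<close> from the complement of \<open>U\<close>. It has no room
  for such a translate disjoint from \<open>P\<close>.
\<close>
lemma Steinhaus:
  fixes P :: "real set"
  assumes P: "compact P" and pos: "emeasure lborel P > 0"
  obtains d where "d > 0" "\<And>x. \<bar>x\<bar> < d \<Longrightarrow> \<exists>p\<in>P. \<exists>q\<in>P. x = p - q"
proof -
  have fin: "emeasure lborel P \<noteq> \<infinity>"
    using emeasure_compact_finite[OF P] by simp
  define m where "m = measure lborel P"
  have m: "emeasure lborel P = ennreal m" "m > 0"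
    using pos fin by (auto simp: m_def emeasure_eq_ennreal_measure zero_less_iff_neq_zero less_le)
  have Pb: "P \<in> sets borel"
    using P by (simp add: borel_compact)
  obtain U where U: "open U" "P \<subseteq> U" "emeasure lborel (U - P) < ennreal m"
    using outer_regular_lborel[OF Pb m(2)] by blast
  have "closed (- U)" "P \<inter> - U = {}"
    using U(1,2) by auto
  then have "\<exists>d>0. \<forall>x\<in>P. \<forall>y\<in>- U. d \<le> dist x y"
    by (rule separate_compact_closed[OF P])
  then obtain d where d: "d > 0" "\<And>x y. x \<in> P \<Longrightarrow> y \<in> - U \<Longrightarrow> d \<le> dist x y"
    by blast
  show ?thesis
  proof (rule that[OF d(1)])
    fix x :: real assume x: "\<bar>x\<bar> < d"
    show "\<exists>p\<in>P. \<exists>q\<in>P. x = p - q"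
    proof (rule ccontr)
      assume "\<not> ?thesis"
      then have "(+) x ` P \<inter> P = {}"
        by force
      moreover have "(+) x ` P \<subseteq> U"
      proof (rule image_subsetI, rule ccontr)
        fix p assume "p \<in> P" "x + p \<notin> U"
        then have "d \<le> dist p (x + p)"
          using d(2) by auto
        with x show False by (simp add: dist_real_def)
      qed
      ultimately have sub: "(+) x ` P \<subseteq> U - P"
        by blast
      have "emeasure lborel P = emeasure lborel ((+) x ` P)"
      proof -
        have "emeasure lborel P = emeasure (distr lborel borel ((+) (-x))) P"
          by (simp only: lborel_distr_plus)
        also have "\<dots> = emeasure lborel ((+) (-x) -` P \<inter> space lborel)"
          using Pb by (intro emeasure_distr) auto
        also have "(+) (-x) -` P \<inter> space lborel = (+) x ` P"
          by (force simp: image_iff)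
        finally show ?thesis .
      qed
      also have "\<dots> \<le> emeasure lborel (U - P)"
        using sub U(1) Pb by (intro emeasure_mono) auto
      finally show False
        using U(3) m(1) by simp
    qed
  qed
qed

lemma compact_subset_positive:
  fixes X :: "real set"
  assumes X: "X \<in> sets borel" "emeasure lborel X > 0" "bounded X"
  obtains P where "compact P" "P \<subseteq> X" "emeasure lborel P > 0"
proof -
  have Xl: "X \<in> sets lebesgue"
    using X(1) by simp
  obtain e' where e': "0 < e'" "e' < emeasure lborel X"
    using dense[OF X(2)] by blast
  obtain e :: real where e: "e > 0" "ennreal e < emeasure lborel X"
  proof (cases e')
    case (real e)
    then show ?thesis using that[of e] e' by simp
  next
    case top
    then show ?thesis using e'(2) by simp
  qed
  obtain T where T: "closed T" "T \<subseteq> X" "X - T \<in> lmeasurable" "emeasure lebesgue (X - T) < ennreal e"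
    using sets_lebesgue_inner_closed[OF Xl e(1)] by blast
  have "emeasure lborel X \<le> emeasure lborel T + emeasure lborel (X - T)"
    using emeasure_subadditive[of T lborel "X - T"] T(1,2) X(1) by (simp add: Un_absorb1)
  moreover have "emeasure lborel (X - T) < ennreal e"
    using T X(1) by simp
  ultimately have "emeasure lborel T \<noteq> 0"
    using e(2) by auto
  moreover have "compact T"
    using T X(3) bounded_subset compact_eq_bounded_closed by blast
  ultimately show ?thesis
    using that T(2) zero_less_iff_neq_zero by blast
qed

text \<open>
  By Fubini, the measure of \<open>W\<close> is the integral of the measures of its sections.
\<close>
lemma positive_section_set:
  fixes W :: "(real \<times> real) set"
  assumes W: "W \<in> sets borel" and pos: "emeasure lborel W > 0"
  defines "X \<equiv> {x. emeasure lborel (Pair x -` W) > 0}"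
  shows "X \<in> sets borel" "emeasure lborel X > 0"
proof -
  have W2: "W \<in> sets (lborel \<Otimes>\<^sub>M lborel)"
    using W unfolding lborel_prod by simp
  have meas: "(\<lambda>x. emeasure lborel (Pair x -` W)) \<in> borel_measurable lborel"
    using lborel.measurable_emeasure_Pair[OF W2] .
  then show X: "X \<in> sets borel"
    unfolding X_def by measurable
  have "emeasure lborel W = (\<integral>\<^sup>+x. emeasure lborel (Pair x -` W) \<partial>lborel)"
    using lborel.emeasure_pair_measure_alt[OF W2] by (simp add: lborel_prod)
  with pos have "\<not> (AE x in lborel. emeasure lborel (Pair x -` W) = 0)"
    using nn_integral_0_iff_AE[OF meas] by auto
  then have "emeasure lborel {x\<in>space lborel. \<not> emeasure lborel (Pair x -` W) = 0} \<noteq> 0"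
    using meas by (subst (asm) AE_iff_measurable[OF _ refl]) auto
  then show "emeasure lborel X > 0"
    by (simp add: X_def zero_less_iff_neq_zero)
qed


section \<open>Covering by affine copies of a subring\<close>

text \<open>
  The key property of the subring. It also shows, with all \<open>a i = 0\<close>, that compact sets of
  positive measure have size continuum.
\<close>
lemma affine_copies_do_not_cover:
  fixes a b :: "'i \<Rightarrow> real"
  assumes D: "real_subring D" and t: "no_quadratic D t" and card: "D \<approx> (UNIV :: real set)"
    and P: "compact P" "emeasure lborel P > 0" and I: "I \<prec> (UNIV :: real set)"
  shows "\<exists>p\<in>P. \<forall>i\<in>I. \<forall>d\<in>D. p \<noteq> b i + a i * d"
proof (rule ccontr)
  assume "\<not> ?thesis"
  then have cov: "\<exists>i\<in>I. \<exists>d\<in>D. p = b i + a i * d" if "p \<in> P" for p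
    using that by blast
  obtain e where e: "e > 0" "\<And>x. \<bar>x\<bar> < e \<Longrightarrow> \<exists>p\<in>P. \<exists>q\<in>P. x = p - q"
    using Steinhaus[OF P] by metis
  define q where "q s = s + s\<^sup>2 * t + s ^ 3 * t\<^sup>2" for s
  define B where "B = (\<lambda>(n :: nat, i, j). {s \<in> D. \<exists>x\<in>D. \<exists>y\<in>D.
      s + s\<^sup>2 * t + s ^ 3 * t\<^sup>2 = n * (b i - b j) + (n * a i) * x + (- n * a j) * y})"
  \<comment> \<open>The factor \<open>n\<close> brings the point \<open>q s\<close> of the curve into the interval of differences of \<open>P\<close>.\<close>
  have "D \<subseteq> (\<Union>z\<in>UNIV \<times> I \<times> I. B z)"
  proof
    fix s assume s: "s \<in> D"
    obtain n :: nat where n: "\<bar>q s\<bar> / e < n"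
      using reals_Archimedean2 by blast
    have n0: "n > 0"
      using n e(1) by (metis abs_ge_zero divide_nonneg_pos gr0I not_le of_nat_0)
    have "\<bar>q s / n\<bar> < e"
      using n n0 e(1) by (simp add: field_simps)
    then obtain u v where "u \<in> P" "v \<in> P" and quv: "q s / n = u - v"
      using e(2) by blast
    then obtain i j x y where ij: "i \<in> I" "j \<in> I" "x \<in> D" "y \<in> D"
      and uv: "u = b i + a i * x" "v = b j + a j * y"
      using cov by metis
    have "q s = n * (u - v)"
      using quv n0 by (simp add: field_simps)
    also have "\<dots> = n * (b i - b j) + (n * a i) * x + (- n * a j) * y"
      by (simp add: uv algebra_simps)
    finally have "s \<in> B (n, i, j)"
      using s ij unfolding B_def q_def by auto
    then show "s \<in> (\<Union>z\<in>UNIV \<times> I \<times> I. B z)"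
      using ij by blast
  qed
  moreover have "(\<Union>z\<in>UNIV \<times> I \<times> I. B z) \<prec> (UNIV :: real set)"
  proof (rule UN_countable_lesspoll_reals)
    show "(UNIV :: nat set) \<times> I \<times> I \<prec> (UNIV :: real set)"
      by (intro Times_lesspoll_reals I countable_lesspoll_reals) simp
    show "countable (B z)" for z
    proof -
      obtain n i j where z: "z = (n, i, j)"
        by (cases z)
      show ?thesis
        using finite_curve_plane[OF D t, of "n * (b i - b j)" "n * a i" "- n * a j"]
        by (simp add: B_def z countable_finite)
    qed
  qed
  ultimately have "D \<prec> (UNIV :: real set)"
    using subset_imp_lepoll lesspoll_trans1 by blast
  then show False
    using card by (simp add: lesspoll_def)
qed


section \<open>Choices along a well-order with small initial segments\<close>

lemma underS_lesspoll: "underS (card_of (UNIV :: 'a set)) a \<prec> (UNIV :: 'a set)"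
proof -
  have "ordLess2 (card_of (underS (card_of (UNIV :: 'a set)) a)) (card_of (UNIV :: 'a set))"
    by (rule card_of_underS) (simp_all add: card_of_card_order_on Field_card_of)
  then have "\<not> (UNIV :: 'a set) \<lesssim> underS (card_of UNIV) a"
    using not_ordLess_ordLeq by (auto simp: lepoll_def card_of_ordLeq)
  moreover have "underS (card_of UNIV) a \<lesssim> (UNIV :: 'a set)"
    by (rule subset_imp_lepoll) auto
  ultimately show ?thesis
    by (auto simp: lesspoll_def dest!: eqpoll_sym[THEN eqpoll_imp_lepoll])
qed


lemma small_well_order:
  obtains R :: "('a \<times> 'a) set" where "wf R" "\<And>x y. x \<noteq> y \<Longrightarrow> (x, y) \<in> R \<or> (y, x) \<in> R"
    "\<And>x. {y. (y, x) \<in> R} \<prec> (UNIV :: 'a set)"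
proof
  let ?r = "card_of (UNIV :: 'a set)"
  have wo: "well_order_on UNIV ?r"
    by (rule card_of_well_order_on)
  show "wf (?r - Id)"
    using wo by (simp add: well_order_on_def)
  show "(x, y) \<in> ?r - Id \<or> (y, x) \<in> ?r - Id" if "x \<noteq> y" for x y
    using wo that by (auto simp: well_order_on_def linear_order_on_def total_on_def)
  have "{y. (y, x) \<in> ?r - Id} = underS ?r x" for x
    by (auto simp: underS_def)
  then show "{y. (y, x) \<in> ?r - Id} \<prec> (UNIV :: 'a set)" for x
    by (simp add: underS_lesspoll)
qed

text \<open>
  At each stage of the recursion fewer elements are used up than \<open>X i\<close> has.
\<close>
lemma distinct_representatives:
  fixes X :: "'i \<Rightarrow> 'a set"
  assumes "\<And>i. (UNIV :: 'i set) \<lesssim> X i"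
  obtains g where "inj g" "\<And>i. g i \<in> X i"
proof -
  obtain R :: "('i \<times> 'i) set" where R: "wf R" "\<And>x y. x \<noteq> y \<Longrightarrow> (x, y) \<in> R \<or> (y, x) \<in> R"
    "\<And>x. {y. (y, x) \<in> R} \<prec> (UNIV :: 'i set)"
    using small_well_order by blast
  have "\<exists>g. \<forall>i. g i \<in> X i - g ` {j. (j, i) \<in> R}"
  proof (rule dependent_wf_choice[OF R(1), where P = "\<lambda>g i r. r \<in> X i - g ` {j. (j, i) \<in> R}"])
    fix i and g :: "'i \<Rightarrow> 'a"
    have "\<not> X i \<subseteq> g ` {j. (j, i) \<in> R}"
    proof
      assume "X i \<subseteq> g ` {j. (j, i) \<in> R}"
      then have "X i \<lesssim> {j. (j, i) \<in> R}"
        by (rule subset_image_lepoll)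
      then have "X i \<prec> (UNIV :: 'i set)"
        using R(3) lesspoll_trans1 by blast
      then show False
        using assms[of i] lesspoll_trans2 lesspoll_not_refl by blast
    qed
    then show "\<exists>r. r \<in> X i - g ` {j. (j, i) \<in> R}"
      by blast
  next
    fix f g :: "'i \<Rightarrow> 'a" and i r assume "\<And>j. (j, i) \<in> R \<Longrightarrow> f j = g j"
    then have "f ` {j. (j, i) \<in> R} = g ` {j. (j, i) \<in> R}"
      by (intro image_cong) auto
    then show "(r \<in> X i - f ` {j. (j, i) \<in> R}) = (r \<in> X i - g ` {j. (j, i) \<in> R})"
      by simp
  qed
  then obtain g where g: "\<And>i. g i \<in> X i - g ` {j. (j, i) \<in> R}"
    by blast
  have "inj g"
  proof (rule injI, rule ccontr)
    fix i j assume eq: "g i = g j" and "i \<noteq> j"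
    then consider "(i, j) \<in> R" | "(j, i) \<in> R"
      using R(2) by blast
    then show False
    proof cases
      case 1
      then have "g i \<in> g ` {k. (k, j) \<in> R}" by simp
      then show False using g[of j] eq by simp
    next
      case 2
      then have "g j \<in> g ` {k. (k, i) \<in> R}" by simp
      then show False using g[of i] eq by simp
    qed
  qed
  with g that show ?thesis
    by blast
qed

text \<open>
  The condition on \<open>F x\<close> and \<open>F y\<close> is symmetric in \<open>x\<close> and \<open>y\<close> because it changes sign on both
  sides; so it is enough to impose it when the later of the two values is chosen.
\<close>
lemma recursive_selection:
  fixes f :: "real \<Rightarrow> real" and P :: "real \<Rightarrow> real set"
  assumes D: "real_subring D" and t: "no_quadratic D t" and card: "D \<approx> (UNIV :: real set)"
    and P: "\<And>x. compact (P x)" "\<And>x. emeasure lborel (P x) > 0"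
  obtains F where "\<And>x. F x \<in> P x"
    "\<And>x y k. x \<noteq> y \<Longrightarrow> k \<in> D \<Longrightarrow> F x - F y \<noteq> k * (f x - f y)"
proof -
  obtain R :: "(real \<times> real) set" where R: "wf R" "\<And>x y. x \<noteq> y \<Longrightarrow> (x, y) \<in> R \<or> (y, x) \<in> R"
    "\<And>x. {y. (y, x) \<in> R} \<prec> (UNIV :: real set)"
    using small_well_order by blast
  let ?ok = "\<lambda>F x r. r \<in> P x \<and> (\<forall>y k. (y, x) \<in> R \<longrightarrow> k \<in> D \<longrightarrow> r \<noteq> F y + (f x - f y) * k)"
  have "\<exists>F. \<forall>x. ?ok F x (F x)"
  proof (rule dependent_wf_choice[OF R(1), where P = ?ok])
    fix x and F :: "real \<Rightarrow> real"
    obtain r where "r \<in> P x" "\<And>y k. y \<in> {y. (y, x) \<in> R} \<Longrightarrow> k \<in> D \<Longrightarrow> r \<noteq> F y + (f x - f y) * k"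
      using affine_copies_do_not_cover[OF D t card P[of x] R(3)[of x],
          where b = F and a = "\<lambda>y. f x - f y"] by blast
    then show "\<exists>r. ?ok F x r"
      by blast
  next
    fix F G :: "real \<Rightarrow> real" and x r assume "\<And>y. (y, x) \<in> R \<Longrightarrow> F y = G y"
    then show "?ok F x r = ?ok G x r"
      by metis
  qed
  then obtain F where F: "\<And>x. ?ok F x (F x)"
    by blast
  have "F x - F y \<noteq> k * (f x - f y)" if "x \<noteq> y" "k \<in> D" for x y k
  proof
    assume "F x - F y = k * (f x - f y)"
    then have "F x = F y + (f x - f y) * k" "F y = F x + (f y - f x) * k"
      by (simp_all add: algebra_simps)
    then show False
      using R(2)[OF that(1)] F[of x] F[of y] that(2) by blast
  qed
  with F that show ?thesis
    by blast
qed


section \<open>Area and Hausdorff dimension\<close>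

text \<open>
  The circumscribed square gives a cruder constant than the area of the disk, which is harmless
  for the dimension.
\<close>
lemma emeasure_ball_le_square:
  fixes c :: "real \<times> real"
  assumes "r > 0"
  shows "emeasure lborel (ball c r) \<le> ennreal (4 * r\<^sup>2)"
proof -
  obtain a b where c: "c = (a, b)" by (cases c)
  have "ball c r \<subseteq> {a - r..a + r} \<times> {b - r..b + r}"
  proof
    fix p assume p: "p \<in> ball c r"
    obtain x y where [simp]: "p = (x, y)" by (cases p)
    have "\<bar>a - x\<bar> \<le> dist c p" "\<bar>b - y\<bar> \<le> dist c p"
      using dist_fst_le[of c p] dist_snd_le[of c p] by (auto simp: c dist_real_def)
    with p show "p \<in> {a - r..a + r} \<times> {b - r..b + r}"
      by (auto simp: c)
  qed
  then have "emeasure lborel (ball c r) \<le> emeasure lborel ({a - r..a + r} \<times> {b - r..b + r})"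
    by (intro emeasure_mono) (auto simp: borel_closed closed_Times)
  also have "\<dots> = emeasure lborel {a - r..a + r} * emeasure lborel {b - r..b + r}"
    by (subst lborel_prod[symmetric], intro lborel.emeasure_pair_measure_Times) auto
  also have "\<dots> = ennreal (4 * r\<^sup>2)"
    using assms by (simp add: ennreal_mult[symmetric] power2_eq_square)
  finally show ?thesis .
qed

lemma suminf_eq_infsum_ennreal:
  fixes g :: "nat \<Rightarrow> ennreal"
  shows "(\<Sum>i. g i) = (\<Sum>\<^sub>\<infinity>i. g i)"
proof -
  have "(g has_sum (\<Sum>\<^sub>\<infinity>i. g i)) UNIV"
    by (intro has_sum_infsum nonneg_summable_on_complete) simp
  then show ?thesis
    using has_sum_imp_sums sums_unique by metis
qed

lemma emeasure_UN_le_infsum: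
  fixes A :: "nat \<Rightarrow> 'a set"
  assumes "\<And>i. i \<in> I \<Longrightarrow> A i \<in> sets M"
  shows "emeasure M (\<Union>i\<in>I. A i) \<le> (\<Sum>\<^sub>\<infinity>i\<in>I. emeasure M (A i))"
proof -
  let ?B = "\<lambda>i. if i \<in> I then A i else {}"
  have "(\<Union>i\<in>I. A i) = (\<Union>i. ?B i)"
    by auto
  then have "emeasure M (\<Union>i\<in>I. A i) = emeasure M (\<Union>i. ?B i)"
    by (rule arg_cong)
  also have "\<dots> \<le> (\<Sum>i. emeasure M (?B i))"
    using assms by (intro emeasure_subadditive_countably) auto
  also have "\<dots> = (\<Sum>\<^sub>\<infinity>i. emeasure M (?B i))"
    by (rule suminf_eq_infsum_ennreal)
  also have "\<dots> = (\<Sum>\<^sub>\<infinity>i\<in>I. emeasure M (A i))"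
    by (rule infsum_cong_neutral) auto
  finally show ?thesis .
qed

text \<open>
  A cover by disks of radii \<open>r i < 1\<close> has total area at most \<open>\<Sum> 4 (r i)\<^sup>2 \<le> 4 \<Sum> (r i) powr s\<close>.
\<close>
lemma hausdorff_measure_pos:
  assumes a: "a > 0" and big: "\<And>U. open U \<Longrightarrow> E \<subseteq> U \<Longrightarrow> emeasure lborel U \<ge> ennreal a"
    and s: "s \<le> 2"
  shows "hausdorff_measure s E > 0"
proof -
  have "ennreal (a / 4) \<le> hausdorff_premeasure s 1 E"
    unfolding hausdorff_premeasure_def
  proof (rule Inf_greatest, clarify)
    fix I c r assume "disk_cover 1 E I c r"
    then have r: "\<And>i. i \<in> I \<Longrightarrow> 0 < r i \<and> r i < 1" and cov: "E \<subseteq> (\<Union>i\<in>I. ball (c i) (r i))"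
      by (auto simp: disk_cover_def)
    have le: "emeasure lborel (ball (c i) (r i)) \<le> 4 * ennreal (r i powr s)" if "i \<in> I" for i
    proof -
      have "emeasure lborel (ball (c i) (r i)) \<le> ennreal (4 * (r i)\<^sup>2)"
        using r[OF that] by (intro emeasure_ball_le_square) auto
      also have "(r i)\<^sup>2 = r i powr 2"
        using r[OF that] by simp
      also have "ennreal (4 * r i powr 2) \<le> ennreal (4 * r i powr s)"
        using r[OF that] s by (intro ennreal_leI mult_left_mono powr_mono') auto
      also have "\<dots> = 4 * ennreal (r i powr s)"
        by (simp add: ennreal_mult)
      finally show ?thesis .
    qed
    have "ennreal a \<le> emeasure lborel (\<Union>i\<in>I. ball (c i) (r i))"
      using cov by (intro big) auto
    also have "\<dots> \<le> (\<Sum>\<^sub>\<infinity>i\<in>I. emeasure lborel (ball (c i) (r i)))"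
      by (rule emeasure_UN_le_infsum) simp
    also have "\<dots> \<le> (\<Sum>\<^sub>\<infinity>i\<in>I. 4 * ennreal (r i powr s))"
      using le by (intro infsum_mono nonneg_summable_on_complete) auto
    also have "\<dots> = 4 * (\<Sum>\<^sub>\<infinity>i\<in>I. ennreal (r i powr s))"
    proof -
      have "(\<Sum>\<^sub>\<infinity>i\<in>I. 4 * h i) = 4 * (\<Sum>\<^sub>\<infinity>i\<in>I. h i)" for h :: "nat \<Rightarrow> ennreal"
      proof -
        have "(\<Sum>\<^sub>\<infinity>i\<in>I. 4 * h i) = (\<Sum>\<^sub>\<infinity>i. 4 * (if i \<in> I then h i else 0))"
          by (rule infsum_cong_neutral) auto
        also have "\<dots> = 4 * (\<Sum>\<^sub>\<infinity>i. if i \<in> I then h i else 0)"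
          by (simp flip: suminf_eq_infsum_ennreal)
        also have "(\<Sum>\<^sub>\<infinity>i. if i \<in> I then h i else 0) = (\<Sum>\<^sub>\<infinity>i\<in>I. h i)"
          by (rule infsum_cong_neutral) auto
        finally show ?thesis .
      qed
      then show ?thesis .
    qed
    finally have *: "ennreal a \<le> 4 * (\<Sum>\<^sub>\<infinity>i\<in>I. ennreal (r i powr s))" (is "_ \<le> 4 * ?S") .
    show "ennreal (a / 4) \<le> ?S"
    proof (cases "?S")
      case (real x)
      with * have "ennreal a \<le> ennreal (4 * x)"
        by (simp add: ennreal_mult)
      with real show ?thesis
        by (simp add: ennreal_le_iff)
    qed simp
  qed
  also have "\<dots> \<le> hausdorff_measure s E"
    unfolding hausdorff_measure_eq_SUP by (rule SUP_upper) simp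
  finally show ?thesis
    using a by (metis divide_pos_pos ennreal_less_zero_iff order_less_le_trans zero_less_numeral)
qed

text \<open>
  The \<open>n\<^sup>2\<close> disks of radius \<open>2 / n\<close> around the points of the grid of mesh \<open>1 / n\<close> cover the unit
  square, and \<open>n\<^sup>2 (2 / n) powr s\<close> tends to 0.
\<close>
lemma hausdorff_measure_square:
  assumes E: "E \<subseteq> {0..<1} \<times> {0..<1}" and s: "s > 2"
  shows "hausdorff_measure s E = 0"
proof -
  have bound: "hausdorff_premeasure s \<delta> E \<le> ennreal (2 powr s * real n powr (2 - s))"
    if n: "n > 0" "2 / real n < \<delta>" for n :: nat and \<delta>
  proof -
    \<comment> \<open>The grid points are numbered by \<open>i * n + j\<close>, row by row.\<close>
    let ?c = "\<lambda>i :: nat. (real (i div n) / n, real (i mod n) / n)"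
    have "disk_cover \<delta> E {..<n * n} ?c (\<lambda>_. 2 / n)"
      unfolding disk_cover_def
    proof (intro conjI ballI subsetI)
      fix p assume "p \<in> E"
      then have "p \<in> {0..<1} \<times> {0..<1}"
        using E by blast
      then obtain x y where p: "p = (x, y)" "0 \<le> x" "x < 1" "0 \<le> y" "y < 1"
        by auto
      define i where "i = nat \<lfloor>n * x\<rfloor>"
      define j where "j = nat \<lfloor>n * y\<rfloor>"
      have fl: "real (nat \<lfloor>n * u\<rfloor>) \<le> n * u" "n * u < real (nat \<lfloor>n * u\<rfloor>) + 1" if "0 \<le> u" for u :: real
        using that by simp_all
      have "n * x < n" "n * y < n"
        using p n(1) by simp_all
      then have "real i < n" "real j < n"
        using fl(1)[OF p(2)] fl(1)[OF p(4)] unfolding i_def j_def by linarith+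
      then have ij: "i < n" "j < n" by auto
      have "i * n + j < (i + 1) * n" using ij by simp
      also have "\<dots> \<le> n * n" using ij by (intro mult_right_mono) auto
      finally have mem: "i * n + j \<in> {..<n * n}" by simp
      have d: "\<bar>real k / n - u\<bar> < 1 / n" if "real k \<le> n * u" "n * u < real k + 1" for k and u :: real
      proof -
        have "real k / n \<le> u" "u < (real k + 1) / n"
          using that n(1) by (simp_all add: field_simps)
        then show ?thesis by (simp add: add_divide_distrib)
      qed
      have "dist (?c (i * n + j)) p = sqrt ((real i / n - x)\<^sup>2 + (real j / n - y)\<^sup>2)"
        using ij by (simp add: p dist_Pair_Pair dist_real_def)
      also have "\<dots> \<le> \<bar>real i / n - x\<bar> + \<bar>real j / n - y\<bar>"
        by (rule sqrt_sum_squares_le_sum_abs)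
      also have "\<dots> < 1 / n + 1 / n"
        unfolding i_def j_def by (intro add_strict_mono d fl p)
      finally have "dist (?c (i * n + j)) p < 2 / n" by simp
      with mem show "p \<in> (\<Union>i\<in>{..<n * n}. ball (?c i) (2 / n))"
        by (auto intro!: bexI[of _ "i * n + j"] simp del: mem_ball simp: mem_ball)
    qed (use n in auto)
    then have "hausdorff_premeasure s \<delta> E \<le> (\<Sum>\<^sub>\<infinity>i\<in>{..<n * n}. ennreal ((2 / n) powr s))"
      unfolding hausdorff_premeasure_def
      by (intro Inf_lower CollectI exI[of _ "{..<n * n}"] exI[of _ ?c] exI[of _ "\<lambda>_. 2 / real n"] conjI refl)
    also have "\<dots> = ennreal (real (n * n) * (2 / n) powr s)"
      by (simp add: ennreal_mult ennreal_of_nat_eq_real_of_nat)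
    also have "real (n * n) * (2 / n) powr s = 2 powr s * real n powr (2 - s)"
      using n(1) by (simp add: powr_divide powr_diff power2_eq_square)
    finally show ?thesis .
  qed
  have lim: "(\<lambda>n. ennreal (2 powr s * real n powr (2 - s))) \<longlonglongrightarrow> 0"
  proof -
    have "(\<lambda>n. 2 powr s * real n powr (2 - s)) \<longlonglongrightarrow> 2 powr s * 0"
      using s by (intro tendsto_intros tendsto_neg_powr filterlim_real_sequentially) auto
    then show ?thesis
      using tendsto_ennrealI by fastforce
  qed
  have "hausdorff_premeasure s \<delta> E = 0" if "\<delta> > 0" for \<delta>
  proof -
    have "eventually (\<lambda>n. 2 / real n < \<delta>) sequentially"
      by (rule order_tendstoD(2)[OF _ that]) (rule lim_const_over_n)
    then have "eventually (\<lambda>n. hausdorff_premeasure s \<delta> E \<le> ennreal (2 powr s * real n powr (2 - s))) sequentially"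
      using eventually_gt_at_top[of 0] by eventually_elim (use bound in auto)
    then have "hausdorff_premeasure s \<delta> E \<le> 0"
      by (rule tendsto_lowerbound[OF lim]) simp
    then show ?thesis by simp
  qed
  then show ?thesis
    unfolding hausdorff_measure_eq_SUP by (simp add: SUP_eq_const)
qed

text \<open>
  The last hypothesis says that the outer area of \<open>E\<close> is at least \<open>a\<close>. The graph of an arbitrary
  function may fail to be measurable, so outer area is the notion to work with.
\<close>
lemma hausdorff_dim_eq_2:
  assumes "E \<subseteq> {0..<1} \<times> {0..<1}"
    and "a > 0" "\<And>U. open U \<Longrightarrow> E \<subseteq> U \<Longrightarrow> emeasure lborel U \<ge> ennreal a"
  shows "hausdorff_dim E = 2"
proof (rule antisym)
  have "hausdorff_dim E \<le> ereal s" if "s > 2" for s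
    unfolding hausdorff_dim_def
    using hausdorff_measure_square[OF assms(1) that] that by (intro INF_lower) auto
  then have "hausdorff_dim E \<le> ereal (2 + e)" if "e > 0" for e
    using that by simp
  then have "hausdorff_dim E \<le> 2 + ereal e" if "e > 0" for e
    using that by simp
  then show "hausdorff_dim E \<le> 2"
    by (metis ereal_le_epsilon2)
  show "2 \<le> hausdorff_dim E"
    unfolding hausdorff_dim_def
  proof (rule INF_greatest)
    fix s assume "s \<in> {s. 0 \<le> s \<and> hausdorff_measure s E = 0}"
    then have "\<not> s \<le> 2"
      using hausdorff_measure_pos[where E = E and a = a and s = s] assms(2,3) by auto
    then have "ereal 2 \<le> ereal s"
      by simp
    then show "2 \<le> ereal s"
      by simp
  qed
qed

section \<open>The graph\<close>

text \<open>
  Open sets \<open>U N\<close> of the plane are coded by sets \<open>N\<close> of naturals, so there are only continuum many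
  of them. To each \<open>U N\<close> of area less than \<open>1/4\<close> a point \<open>g N\<close> of its own is assigned, over
  which the rest \<open>W N\<close> of the square \<open>S\<close> has a vertical section of positive length; there are
  enough such points since by Fubini they form a set of positive measure. If \<open>F (g N)\<close> is taken
  from that section, the graph is not contained in \<open>U N\<close>. The side \<open>1/2\<close> of \<open>S\<close> keeps the compact
  square inside the half-open one.
\<close>
theorem theorem3p1:
  fixes f :: "real \<Rightarrow> real"
  shows "\<exists>(K :: real set) (F :: real \<Rightarrow> real).
           F ` {0..<1} \<subseteq> {0..<1} \<and>
           K \<approx> (UNIV :: real set) \<and>
           hausdorff_dim (graph_on {0..<1} F) = 2 \<and>
           (\<forall>k\<in>K. \<forall>C. \<exists>\<^sub>\<le>\<^sub>1 p. p \<in> graph_on {0..<1} F \<inter> graph_on {0..<1} (\<lambda>x. k * f x + C))"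
proof -
  obtain D t where D: "real_subring D" and t: "no_quadratic D t" and card: "D \<approx> (UNIV :: real set)"
    using exists_large_subring by blast
  obtain B :: "nat \<Rightarrow> (real \<times> real) set" where "inj B" and B: "\<And>n. open (B n)"
    "\<And>S. open S \<Longrightarrow> \<exists>N. S = \<Union>{B n |n. n \<in> N}"
    by (rule univ_second_countable_sequence, rule that)
  define U where "U N = \<Union>{B n |n. n \<in> N}" for N
  have oU: "open (U N)" for N
    using B(1) by (auto simp: U_def)
  define S where "S = {0..1/2 :: real} \<times> {0..1/2 :: real}"
  define W where "W N = S - U N" for N
  define X where "X N = {x. emeasure lborel (Pair x -` W N) > 0}" for N
  define good where "good N \<longleftrightarrow> emeasure lborel (U N) < ennreal (1/4)" for N
  have S: "S \<in> sets borel" "emeasure lborel S = ennreal (1/4)"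
  proof -
    show "S \<in> sets borel"
      unfolding S_def by (intro borel_closed closed_Times) auto
    have "emeasure lborel S = emeasure lborel {0..1/2 :: real} * emeasure lborel {0..1/2 :: real}"
      unfolding S_def by (subst lborel_prod[symmetric], intro lborel.emeasure_pair_measure_Times) auto
    also have "emeasure lborel {0..1/2 :: real} = ennreal (1/2)"
      using emeasure_lborel_Icc[of "0 :: real" "1/2"] by simp
    also have "ennreal (1/2) * ennreal (1/2) = ennreal (1/2 * (1/2))"
      by (rule ennreal_mult[symmetric]) simp_all
    also have "(1/2 * (1/2) :: real) = 1/4"
      by simp
    finally show "emeasure lborel S = ennreal (1/4)" .
  qed
  have W: "W N \<in> sets borel" for N
    using S(1) oU by (auto simp: W_def)
  have sec: "Pair x -` W N \<subseteq> {0..1/2}" "x \<in> {0..1/2}" if "x \<in> X N" for x N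
  proof -
    show "Pair x -` W N \<subseteq> {0..1/2}"
      by (auto simp: W_def S_def)
    have "Pair x -` W N \<noteq> {}"
      using that by (auto simp: X_def)
    then show "x \<in> {0..1/2}"
      by (auto simp: W_def S_def)
  qed
  have X: "(UNIV :: nat set set) \<lesssim> X N" if "good N" for N
  proof -
    have "S \<subseteq> U N \<union> W N"
      by (auto simp: W_def)
    then have "emeasure lborel S \<le> emeasure lborel (U N) + emeasure lborel (W N)"
      using W oU by (intro order_trans[OF emeasure_mono emeasure_subadditive]) auto
    with \<open>good N\<close> have "emeasure lborel (W N) > 0"
      by (auto simp: S good_def zero_less_iff_neq_zero)
    then have "X N \<in> sets borel" "emeasure lborel (X N) > 0"
      unfolding X_def using positive_section_set[OF W] by blast+
    moreover have "bounded (X N)"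
      using sec(2) bounded_subset[OF bounded_closed_interval] by blast
    ultimately obtain P where P: "compact P" "P \<subseteq> X N" "emeasure lborel P > 0"
      using compact_subset_positive by blast
    have "\<not> P \<prec> (UNIV :: real set)"
    proof
      assume "P \<prec> (UNIV :: real set)"
      then obtain p where "p \<in> P" "\<And>i d. i \<in> P \<Longrightarrow> d \<in> D \<Longrightarrow> p \<noteq> i + 0 * d"
        using affine_copies_do_not_cover[OF D t card P(1,3), where b = "\<lambda>i. i" and a = "\<lambda>_. 0"]
        by blast
      then show False
        using subring_0[OF D] by fastforce
    qed
    then have "P \<approx> (UNIV :: real set)"
      using lepoll_iff_leqpoll subset_imp_lepoll by blast
    then have "(UNIV :: nat set set) \<lesssim> P"
      using nat_sets_eqpoll_reals eqpoll_imp_lepoll eqpoll_sym eqpoll_trans by blast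
    then show ?thesis
      using P(2) lepoll_trans subset_imp_lepoll by blast
  qed
  have "(UNIV :: nat set set) \<lesssim> (if good N then X N else UNIV)" for N
    using X[of N] eqpoll_imp_lepoll[OF nat_sets_eqpoll_reals] by (cases "good N") simp_all
  then obtain g where g: "inj g" "\<And>N. g N \<in> (if good N then X N else UNIV)"
    using distinct_representatives[of "\<lambda>N. if good N then X N else UNIV"] by blast
  have gX: "g N \<in> X N" if "good N" for N
    using g(2)[of N] that by simp
  \<comment> \<open>Points to which no open set is assigned get an arbitrary compact set of positive length.\<close>
  define P where "P x = (if \<exists>N. good N \<and> g N = x then Pair x -` W (inv g x) else {0..1/2})" for x
  have Pg: "P (g N) = Pair (g N) -` W N" if "good N" for N
    using that g(1) by (auto simp: P_def)
  have P: "compact (P x) \<and> emeasure lborel (P x) > 0 \<and> P x \<subseteq> {0..1/2}" for x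
  proof (cases "\<exists>N. good N \<and> g N = x")
    case True
    then obtain N where N: "good N" "g N = x" by blast
    have "x \<in> X N"
      using gX N by blast
    have "P x = {0..1/2} \<inter> Pair x -` (- U N)"
      using Pg[OF N(1)] N(2) sec(2)[OF \<open>x \<in> X N\<close>] by (auto simp: W_def S_def)
    moreover have "closed (Pair x -` (- U N))"
      using oU by (intro closed_vimage) (auto intro!: continuous_intros)
    ultimately have "compact (P x)"
      by (simp add: compact_Int_closed)
    then show ?thesis
      using Pg[OF N(1)] N(2) sec(1)[OF \<open>x \<in> X N\<close>] \<open>x \<in> X N\<close> by (auto simp: X_def)
  next
    case False
    then show ?thesis
      by (auto simp: P_def zero_less_iff_neq_zero)
  qed
  obtain F where F: "\<And>x. F x \<in> P x"
    "\<And>x y k. x \<noteq> y \<Longrightarrow> k \<in> D \<Longrightarrow> F x - F y \<noteq> k * (f x - f y)"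
    using recursive_selection[OF D t card, of P f] P by blast
  have F01: "0 \<le> F x" "F x < 1" for x
  proof -
    have "F x \<in> {0..1/2}"
      using F(1)[of x] P[of x] by blast
    then show "0 \<le> F x" "F x < 1" by auto
  qed
  let ?G = "graph_on {0..<1} F"
  have "hausdorff_dim ?G = 2"
  proof (rule hausdorff_dim_eq_2)
    show "?G \<subseteq> {0..<1} \<times> {0..<1}"
      using F01 by (auto simp: graph_on_def)
    show "(0 :: real) < 1/4" by simp
    fix V :: "(real \<times> real) set" assume V: "open V" "?G \<subseteq> V"
    obtain N where N: "V = U N"
      using B(2)[OF V(1)] by (auto simp: U_def)
    show "ennreal (1/4) \<le> emeasure lborel V"
    proof (rule ccontr)
      assume "\<not> ?thesis"
      then have "good N"
        by (simp add: good_def N)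
      then have "(g N, F (g N)) \<in> W N"
        using F(1)[of "g N"] Pg by auto
      then have "(g N, F (g N)) \<notin> V"
        by (simp add: W_def N)
      moreover have "g N \<in> {0..<1}"
        using sec(2)[OF gX[OF \<open>good N\<close>]] by auto
      ultimately show False
        using V(2) by (auto simp: graph_on_def)
    qed
  qed
  moreover have "\<exists>\<^sub>\<le>\<^sub>1 p. p \<in> ?G \<inter> graph_on {0..<1} (\<lambda>x. k * f x + C)" if k: "k \<in> D" for k C
  proof (rule Uniq_I)
    fix p p' assume "p \<in> ?G \<inter> graph_on {0..<1} (\<lambda>x. k * f x + C)"
      "p' \<in> ?G \<inter> graph_on {0..<1} (\<lambda>x. k * f x + C)"
    then obtain x y where xy: "p = (x, F x)" "F x = k * f x + C" "p' = (y, F y)" "F y = k * f y + C"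
      by (auto simp: graph_on_def)
    then have "F x - F y = k * (f x - f y)"
      by (simp add: algebra_simps)
    then have "x = y"
      using F(2)[of x y k] k by blast
    then show "p = p'"
      by (simp add: xy)
  qed
  ultimately show ?thesis
    using card F01 by (intro exI[of _ D] exI[of _ F]) auto
qed

end
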